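(* For $\nu=0,1$ let $r_\nu\ge1$, let $s^{(\nu)}\in\mathbb{Z}_{>0}^{r_\nu}$, and let $\rho_\nu$ be a linear preorder on $\{1,\dots,r_\nu\}$. Put $r=r_0+r_1$ and let $s\in\mathbb{Z}_{>0}^{r}$ be the concatenation of $s^{(0)}$ and $s^{(1)}$. Then $$\zeta_{\rho_0}(s^{(0)})\,\zeta_{\rho_1}(s^{(1)})=\sum_\rho\zeta_\rho(s),$$ where the sum is over all linear preorders $\rho$ on $\{1,\dots,r\}$ such that the restriction of $\rho$ to $\{1,\dots,r_0\}$ is $\rho_0$ and the restriction of $\rho$ to $\{r_0+1,\dots,r_0+r_1\}$ is $\rho_1$ shifted by $r_0$ (i.e. $(r_0+i)\,\rho\,(r_0+j)$ if and only if $i\,\rho_1\,j$). Consequently, the $\mathbb{F}_p$-linear combinations of the values $\zeta_\rho(s)$ (over all $r\geq 1$, all $s\in\mathbb{Z}_{>0}^r$ and all linear preorders $\rho$ on $\{1,\dots,r\}$) form an algebra over $\mathbb{F}_p$, i.e. their span is closed under multiplication.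
   Context: Let $q$ be a power of a prime $p$, $A=\mathbb{F}_q[t]$, $A_+$ the set of monic polynomials in $A$, and $K_\infty=\mathbb{F}_q((1/t))$. For integers $k\ge1$ and $d\ge0$ put $S_d(k)=\sum_{a\in A_+,\ \deg a=d}a^{-k}$. For $d=(d_1,\dots,d_r)\in\mathbb{Z}_{\ge0}^r$ and $s=(s_1,\dots,s_r)\in\mathbb{Z}_{>0}^r$ put $S_d(s)=\prod_{i=1}^rS_{d_i}(s_i)$. A linear preorder $\rho$ on a set $X$ is a relation that is transitive and satisfies $x\rho y$ or $y\rho x$ for all $x,y\in X$ (in particular it is reflexive). Given a linear preorder $\rho$ on $\{1,\dots,r\}$, let $(\mathbb{Z}_{\ge0})^r_\rho$ be the set of $(n_1,\dots,n_r)\in\mathbb{Z}_{\ge0}^r$ such that for all $i,j\in\{1,\dots,r\}$: $i\rho j$ if and only if $n_i\le n_j$. For $s\in\mathbb{Z}_{>0}^r$ put $$\zeta_\rho(s)=\sum_{d\in(\mathbb{Z}_{\ge0})^r_\rho}S_d(s)\in K_\infty$$ (a convergent sum in $K_\infty$). These are the (degenerate and nondegenerate) multizeta values. *)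

theory Defs
  imports
    "HOL-Computational_Algebra.Formal_Laurent_Series"
    "HOL-Complex_Analysis.Complex_Analysis"
begin

text \<open>
  The finite field \<open>\<F>\<^sub>q\<close> is a type \<open>'a :: {field, finite}\<close>, so that \<open>q = CARD('a)\<close> and
  \<open>p = CHAR('a)\<close>, and \<open>A = 'a poly\<close>. The field \<open>K\<^sub>\<infinity> = \<F>\<^sub>q((1/t))\<close> is \<open>'a fls\<close> with
  \<open>fls_X\<close> playing the role of \<open>1/t\<close>; hence \<open>t\<close> is \<open>fls_X_inv\<close>. The metric on \<open>'a fls\<close>
  induces the \<open>1/t\<close>-adic topology.
\<close>

definition poly_to_Kinf :: "'a :: {field, finite} poly \<Rightarrow> 'a fls" where
  "poly_to_Kinf a = poly (map_poly fls_const a) fls_X_inv"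

definition power_sum :: "nat \<Rightarrow> nat \<Rightarrow> 'a :: {field, finite} fls" where
  "power_sum d k =
     (\<Sum>a | lead_coeff (a :: 'a poly) = 1 \<and> degree a = d. poly_to_Kinf a powi (- int k))"

text \<open>The index set of the sum above is finite, so the sum is not the junk value \<open>0\<close>.\<close>

lemma finite_monic_degree:
  "finite {a :: 'a :: {field, finite} poly. lead_coeff a = 1 \<and> degree a = d}"
proof (rule finite_subset)
  show "{a :: 'a poly. lead_coeff a = 1 \<and> degree a = d}
          \<subseteq> Poly ` {xs. set xs \<subseteq> UNIV \<and> length xs \<le> Suc d}"
  proof
    fix a :: "'a poly"
    assume "a \<in> {a. lead_coeff a = 1 \<and> degree a = d}"
    hence "length (coeffs a) \<le> Suc d"
      by (cases "a = 0") (auto simp: length_coeffs_degree)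
    moreover have "a = Poly (coeffs a)"
      by simp
    ultimately show "a \<in> Poly ` {xs. set xs \<subseteq> UNIV \<and> length xs \<le> Suc d}"
      by blast
  qed
  show "finite (Poly ` {xs :: 'a list. set xs \<subseteq> UNIV \<and> length xs \<le> Suc d})"
    by (intro finite_imageI finite_lists_length_le) simp
qed

text \<open>
  Tuples of length \<open>r\<close> are lists, and their index set \<open>{1, \<dots>, r}\<close> is rendered as \<open>{..<r}\<close>
  throughout; preorders on it are sets of pairs contained in \<open>{..<r} \<times> {..<r}\<close>.
\<close>

definition multi_power_sum :: "nat list \<Rightarrow> nat list \<Rightarrow> 'a :: {field, finite} fls" where
  "multi_power_sum d s = (\<Prod>i<length s. power_sum (d ! i) (s ! i))"

definition linear_preorder_on :: "'b set \<Rightarrow> 'b rel \<Rightarrow> bool" where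
  "linear_preorder_on X \<rho> \<longleftrightarrow>
     \<rho> \<subseteq> X \<times> X \<and> trans \<rho> \<and> (\<forall>x\<in>X. \<forall>y\<in>X. (x, y) \<in> \<rho> \<or> (y, x) \<in> \<rho>)"

lemma linear_preorder_on_iff: "linear_preorder_on X \<rho> \<longleftrightarrow> preorder_on X \<rho> \<and> total_on X \<rho>"
  by (auto simp: linear_preorder_on_def preorder_on_def refl_on_def total_on_def) metis

definition tuples_of_preorder :: "nat \<Rightarrow> nat rel \<Rightarrow> nat list set" where
  "tuples_of_preorder r \<rho> =
     {n. length n = r \<and> (\<forall>i<r. \<forall>j<r. (i, j) \<in> \<rho> \<longleftrightarrow> n ! i \<le> n ! j)}"

text \<open>
  The sum converges unconditionally in the complete non-archimedean field \<open>K\<^sub>\<infinity>\<close>, as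
  \<open>power_sum d k\<close> has \<open>1/t\<close>-adic valuation at least \<open>d * k\<close>; thus the default value \<open>0\<close>
  of \<open>infsum\<close> plays no role for positive exponents.
\<close>

definition multizeta :: "nat rel \<Rightarrow> nat list \<Rightarrow> 'a :: {field, finite} fls" where
  "multizeta \<rho> s = infsum (\<lambda>d. multi_power_sum d s) (tuples_of_preorder (length s) \<rho>)"

definition pos_tuple :: "nat \<Rightarrow> nat list \<Rightarrow> bool" where
  "pos_tuple r s \<longleftrightarrow> length s = r \<and> (\<forall>k\<in>set s. k > 0)"

definition multizeta_values :: "'a :: {field, finite} fls set" where
  "multizeta_values =
     {multizeta \<rho> s | r s \<rho>. r \<ge> 1 \<and> pos_tuple r s \<and> linear_preorder_on {..<r} \<rho>}"

definition joint_preorders :: "nat \<Rightarrow> nat rel \<Rightarrow> nat \<Rightarrow> nat rel \<Rightarrow> nat rel set" where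
  "joint_preorders r\<^sub>0 \<rho>\<^sub>0 r\<^sub>1 \<rho>\<^sub>1 =
     {\<rho>. linear_preorder_on {..<r\<^sub>0 + r\<^sub>1} \<rho> \<and>
         (\<forall>i<r\<^sub>0. \<forall>j<r\<^sub>0. (i, j) \<in> \<rho> \<longleftrightarrow> (i, j) \<in> \<rho>\<^sub>0) \<and>
         (\<forall>i<r\<^sub>1. \<forall>j<r\<^sub>1. (r\<^sub>0 + i, r\<^sub>0 + j) \<in> \<rho> \<longleftrightarrow> (i, j) \<in> \<rho>\<^sub>1)}"

lemma finite_joint_preorders: "finite (joint_preorders r\<^sub>0 \<rho>\<^sub>0 r\<^sub>1 \<rho>\<^sub>1)"
proof (rule finite_subset)
  show "joint_preorders r\<^sub>0 \<rho>\<^sub>0 r\<^sub>1 \<rho>\<^sub>1 \<subseteq> Pow ({..<r\<^sub>0 + r\<^sub>1} \<times> {..<r\<^sub>0 + r\<^sub>1})"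
    by (auto simp only: joint_preorders_def linear_preorder_on_def)
qed simp

text \<open>\<open>\<F>\<^sub>p\<close>, as the image of the integers in \<open>\<F>\<^sub>q\<close>:\<close>

definition prime_subfield :: "'a :: {field, finite} set" where
  "prime_subfield = range of_int"

definition Fp_span :: "'a :: {field, finite} fls set \<Rightarrow> 'a fls set" where
  "Fp_span V =
     {\<Sum>v\<in>T. fls_const (c v) * v | T c. finite T \<and> T \<subseteq> V \<and> (\<forall>v\<in>T. c v \<in> prime_subfield)}"

text \<open>Algebras are not required to contain \<open>1\<close>.\<close>

definition Fp_subalgebra :: "'a :: {field, finite} fls set \<Rightarrow> bool" where
  "Fp_subalgebra V \<longleftrightarrow>
     0 \<in> V \<and>
     (\<forall>x\<in>V. \<forall>y\<in>V. x + y \<in> V) \<and>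
     (\<forall>c\<in>prime_subfield. \<forall>x\<in>V. fls_const c * x \<in> V) \<and>
     (\<forall>x\<in>V. \<forall>y\<in>V. x * y \<in> V)"

end

theory Submission
  imports Defs
begin

text \<open>
  A product of two multizeta values is a sum over all pairs of tuples \<open>d\<close>, \<open>d'\<close> whose entries are
  ordered as \<open>\<rho>\<^sub>0\<close> and \<open>\<rho>\<^sub>1\<close> prescribe. Concatenating such a pair gives one tuple \<open>d @ d'\<close>, whose
  entries are ordered by exactly one linear preorder on the joint index set, and this preorder
  restricts to \<open>\<rho>\<^sub>0\<close> and \<open>\<rho>\<^sub>1\<close>; conversely, every tuple ordered by such a joint preorder splits into
  an admissible pair (\<open>bij_betw_append_tuples_of_preorder\<close>). Since \<open>multi_power_sum\<close> is
  multiplicative under concatenation, grouping the pairs by their joint preorder gives the product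
  formula \<open>multizeta_mult\<close>. Ties \<open>d\<^sub>i = d'\<^sub>j\<close> are accounted for by the joint preorders that are not
  antisymmetric.

  The analytic part justifies the rearrangement. All families concerned are null families: below
  any given exponent, only finitely many members have a nonzero coefficient. A Laurent series is
  determined by its coefficients, and up to a given exponent the sum of a null family is a finite
  sum; so products and finite partitions of index sets are handled by the corresponding rules for
  finite sums (\<open>infsum_mult_null_family\<close>, \<open>infsum_Union_null_family\<close>). The multiple power
  sums form null families because \<open>power_sum d k\<close> has order at least \<open>d\<close> when \<open>k > 0\<close>.

  As every \<open>c \<in> \<F>\<^sub>p\<close> is the image of an integer, the \<open>\<F>\<^sub>p\<close>-span of a set is its \<open>\<int>\<close>-span, and
  its closure under multiplication follows from that of products of generators by bilinearity.
\<close>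

section \<open>Unconditional sums of Laurent series\<close>

definition vanishes_below :: "int \<Rightarrow> 'a::zero fls \<Rightarrow> bool" where
  "vanishes_below m f \<longleftrightarrow> (\<forall>n<m. fls_nth f n = 0)"

lemma vanishes_belowD: "vanishes_below m f \<Longrightarrow> n < m \<Longrightarrow> fls_nth f n = 0"
  by (simp add: vanishes_below_def)

lemma vanishes_below_mono: "vanishes_below m f \<Longrightarrow> n \<le> m \<Longrightarrow> vanishes_below n f"
  by (auto simp: vanishes_below_def)

lemma vanishes_below_le_subdegree: "m \<le> fls_subdegree f \<Longrightarrow> vanishes_below m f"
  by (auto simp: vanishes_below_def)

lemma vanishes_below_imp_le_subdegree: "vanishes_below m f \<Longrightarrow> f \<noteq> 0 \<Longrightarrow> m \<le> fls_subdegree f"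
  by (intro fls_subdegree_geI) (auto simp: vanishes_below_def)

lemma vanishes_below_0 [simp]: "vanishes_below m 0"
  by (simp add: vanishes_below_def)

lemma vanishes_below_diff:
  fixes f g :: "'a::group_add fls"
  shows "vanishes_below m f \<Longrightarrow> vanishes_below m g \<Longrightarrow> vanishes_below m (f - g)"
  by (simp add: vanishes_below_def)

lemma vanishes_below_sum:
  fixes f :: "'b \<Rightarrow> 'a::comm_monoid_add fls"
  shows "(\<And>x. x \<in> F \<Longrightarrow> vanishes_below m (f x)) \<Longrightarrow> vanishes_below m (sum f F)"
  by (simp add: vanishes_below_def fls_nth_sum)

lemma vanishes_below_mult:
  fixes f g :: "'a::{comm_monoid_add, mult_zero} fls"
  assumes "vanishes_below m f" "vanishes_below n g"
  shows "vanishes_below (m + n) (f * g)"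
proof (cases "f = 0 \<or> g = 0")
  case False
  with assms have "m + n \<le> fls_subdegree f + fls_subdegree g"
    by (intro add_mono vanishes_below_imp_le_subdegree) auto
  thus ?thesis
    by (auto simp: vanishes_below_def intro!: fls_times_nth_eq0)
qed auto

lemma vanishes_below_prod:
  fixes f :: "'b \<Rightarrow> 'a::comm_semiring_1 fls"
  assumes "finite I" "\<And>i. i \<in> I \<Longrightarrow> vanishes_below (m i) (f i)"
  shows "vanishes_below (\<Sum>i\<in>I. m i) (\<Prod>i\<in>I. f i)"
  using assms
  by (induction I rule: finite_induct)
     (auto intro: vanishes_below_mult simp: vanishes_below_le_subdegree)

text \<open>Series whose difference has order \<open>k\<close> are at distance \<open>2\<^sup>-\<^sup>k\<close>.\<close>

lemma fls_tendstoI: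
  fixes f :: "'b \<Rightarrow> 'a::group_add fls"
  assumes "\<And>m. eventually (\<lambda>x. vanishes_below m (f x - l)) F"
  shows "(f \<longlongrightarrow> l) F"
proof (rule tendstoI)
  fix e :: real assume "e > 0"
  then obtain m :: nat where m: "(1/2) ^ m < e"
    using real_arch_pow_inv[of e "1/2"] by auto
  show "\<forall>\<^sub>F x in F. dist (f x) l < e"
    using assms[of "int m"]
  proof (rule eventually_mono)
    fix x assume v: "vanishes_below (int m) (f x - l)"
    show "dist (f x) l < e"
    proof (cases "f x = l")
      case False
      define k where "k = fls_subdegree (f x - l)"
      have k: "int m \<le> k"
        unfolding k_def using v False by (intro vanishes_below_imp_le_subdegree) auto
      hence "dist (f x) l = (1/2) ^ nat k"
        using False by (simp add: dist_fls_def power_divide inverse_eq_divide flip: k_def)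
      also have "\<dots> \<le> (1/2) ^ m"
        using k by (intro power_decreasing) auto
      finally show ?thesis using m by simp
    qed (use \<open>e > 0\<close> in auto)
  qed
qed

definition null_family :: "('b \<Rightarrow> 'a::zero fls) \<Rightarrow> 'b set \<Rightarrow> bool" where
  "null_family f A \<longleftrightarrow> (\<forall>m. finite {x\<in>A. \<not> vanishes_below m (f x)})"

lemma null_familyD: "null_family f A \<Longrightarrow> finite {x\<in>A. \<not> vanishes_below m (f x)}"
  by (simp add: null_family_def)

lemma null_family_subset: "null_family f A \<Longrightarrow> B \<subseteq> A \<Longrightarrow> null_family f B"
  unfolding null_family_def by (auto intro: rev_finite_subset)

text \<open>
  Only finitely many members fail to be power series, so their poles have bounded order. This is
  what keeps the product of two null families null.
\<close>

lemma null_family_bounded: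
  assumes "null_family f A"
  obtains N where "\<And>x. x \<in> A \<Longrightarrow> vanishes_below N (f x)"
proof -
  define E where "E = {x\<in>A. \<not> vanishes_below 0 (f x)}"
  define N where "N = Min (insert 0 ((\<lambda>x. fls_subdegree (f x)) ` E))"
  have E: "finite E"
    using null_familyD[OF assms] by (simp add: E_def)
  have "vanishes_below N (f x)" if "x \<in> A" for x
  proof (cases "x \<in> E")
    case True
    thus ?thesis
      unfolding N_def using E by (intro vanishes_below_le_subdegree Min_le) auto
  next
    case False
    with that have "vanishes_below 0 (f x)" by (simp add: E_def)
    moreover have "N \<le> 0" unfolding N_def using E by (intro Min_le) auto
    ultimately show ?thesis by (rule vanishes_below_mono)
  qed
  thus ?thesis by (rule that)
qed

text \<open>
  The only place where the topology enters: convergence of the sum and an explicit approximation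
  come from the series \<open>S\<close> whose coefficients are the finite sums of those of the members.
\<close>

lemma null_family_infsum:
  fixes f :: "'b \<Rightarrow> 'a::ab_group_add fls"
  assumes null: "null_family f A"
    and F: "finite F" "F \<subseteq> A" "\<And>x. x \<in> A - F \<Longrightarrow> vanishes_below m (f x)"
  shows "vanishes_below m (sum f F - infsum f A)"
proof -
  obtain N where N: "\<And>x. x \<in> A \<Longrightarrow> vanishes_below N (f x)"
    using null_family_bounded[OF null] by blast
  define E where "E n = {x\<in>A. \<not> vanishes_below (n + 1) (f x)}" for n
  have E: "finite (E n)" for n
    using null_familyD[OF null] by (simp add: E_def)
  define S where "S = Abs_fls (\<lambda>n. \<Sum>x\<in>E n. fls_nth (f x) n)"
  have S: "fls_nth S n = (\<Sum>x\<in>E n. fls_nth (f x) n)" for n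
    unfolding S_def
  proof (rule nth_Abs_fls_lower_bound[of N])
    show "\<forall>n<N. (\<Sum>x\<in>E n. fls_nth (f x) n) = 0"
      by (auto intro!: sum.neutral vanishes_belowD[OF N] simp: E_def)
  qed
  have approx: "vanishes_below m (sum f F - S)"
    if F: "finite F" "F \<subseteq> A" "\<And>x. x \<in> A - F \<Longrightarrow> vanishes_below m (f x)" for F m
    unfolding vanishes_below_def
  proof (intro allI impI)
    fix n assume n: "n < m"
    have sub: "E n \<subseteq> F"
    proof
      fix x assume "x \<in> E n"
      hence "x \<in> A" "\<not> vanishes_below m (f x)"
        using n vanishes_below_mono[of m "f x" "n + 1"] by (auto simp: E_def)
      with F(3) show "x \<in> F" by blast
    qed
    have "fls_nth (sum f F) n = (\<Sum>x\<in>F. fls_nth (f x) n)"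
      by (simp add: fls_nth_sum)
    also have "\<dots> = (\<Sum>x\<in>E n. fls_nth (f x) n)"
      using F sub by (intro sum.mono_neutral_right) (auto simp: E_def vanishes_below_def)
    finally show "fls_nth (sum f F - S) n = 0" by (simp add: S)
  qed
  have "(f has_sum S) A"
    unfolding has_sum_def
  proof (rule fls_tendstoI)
    fix m
    show "eventually (\<lambda>F. vanishes_below m (sum f F - S)) (finite_subsets_at_top A)"
      unfolding eventually_finite_subsets_at_top
      using null_familyD[OF null, of m]
      by (intro exI[of _ "{x\<in>A. \<not> vanishes_below m (f x)}"]) (auto intro!: approx)
  qed
  hence "infsum f A = S" by (rule infsumI)
  with approx[OF F] show ?thesis by simp
qed

lemma eq_if_vanishes_below:
  fixes f g :: "'a::group_add fls"
  assumes "\<And>m. vanishes_below m (f - g)"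
  shows "f = g"
proof (rule fls_eqI)
  fix n
  show "fls_nth f n = fls_nth g n"
    using vanishes_belowD[OF assms[of "n + 1"], of n] by simp
qed

lemma infsum_Union_null_family:
  fixes f :: "'b \<Rightarrow> 'a::ab_group_add fls"
  assumes null: "null_family f (\<Union>i\<in>I. A i)"
    and I: "finite I" and disj: "disjoint_family_on A I"
  shows "infsum f (\<Union>i\<in>I. A i) = (\<Sum>i\<in>I. infsum f (A i))"
proof (rule eq_if_vanishes_below)
  fix m
  define E where "E = {x\<in>(\<Union>i\<in>I. A i). \<not> vanishes_below m (f x)}"
  have E: "finite E" "E \<subseteq> (\<Union>i\<in>I. A i)"
    using null_familyD[OF null] by (auto simp: E_def)
  have "sum f E = sum f (\<Union>i\<in>I. A i \<inter> E)"
    using E by (intro sum.cong) auto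
  also have "\<dots> = (\<Sum>i\<in>I. sum f (A i \<inter> E))"
    using I E disj by (intro sum.UNION_disjoint) (auto simp: disjoint_family_on_def)
  finally have split: "sum f E = (\<Sum>i\<in>I. sum f (A i \<inter> E))" .
  have "vanishes_below m (sum f E - infsum f (\<Union>i\<in>I. A i))"
    using null E by (intro null_family_infsum) (auto simp: E_def)
  moreover have "vanishes_below m (\<Sum>i\<in>I. sum f (A i \<inter> E) - infsum f (A i))"
    using E by (intro vanishes_below_sum null_family_infsum null_family_subset[OF null])
               (auto simp: E_def)
  ultimately show "vanishes_below m (infsum f (\<Union>i\<in>I. A i) - (\<Sum>i\<in>I. infsum f (A i)))"
    by (auto simp: vanishes_below_def sum_subtractf split)
qed

lemma null_family_mult:
  fixes f :: "'b \<Rightarrow> 'a::comm_ring fls" and g :: "'c \<Rightarrow> 'a fls"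
  assumes f: "null_family f A" and g: "null_family g B"
  shows "null_family (\<lambda>(x, y). f x * g y) (A \<times> B)"
  unfolding null_family_def
proof
  fix m
  obtain M where M: "\<And>x. x \<in> A \<Longrightarrow> vanishes_below M (f x)"
    using null_family_bounded[OF f] by blast
  obtain N where N: "\<And>y. y \<in> B \<Longrightarrow> vanishes_below N (g y)"
    using null_family_bounded[OF g] by blast
  have "{p\<in>A \<times> B. \<not> vanishes_below m (case p of (x, y) \<Rightarrow> f x * g y)}
          \<subseteq> {x\<in>A. \<not> vanishes_below (m - N) (f x)} \<times> {y\<in>B. \<not> vanishes_below (m - M) (g y)}"
    using vanishes_below_mult[OF _ N, of "m - N"] vanishes_below_mult[OF M, of _ "m - M"]
    by auto
  thus "finite {p\<in>A \<times> B. \<not> vanishes_below m (case p of (x, y) \<Rightarrow> f x * g y)}"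
    by (rule finite_subset) (intro finite_cartesian_product null_familyD f g)
qed

text \<open>
  Modulo any power of \<open>fls_X\<close> both sides are finite sums. If the members of \<open>f\<close> and \<open>g\<close> have order
  at least \<open>M\<close> and \<open>N\<close>, precision \<open>m\<close> in the product needs precision \<open>m - N\<close> for \<open>f\<close> and \<open>m - M\<close>
  for \<open>g\<close>.
\<close>

lemma infsum_mult_null_family:
  fixes f :: "'b \<Rightarrow> 'a::comm_ring fls" and g :: "'c \<Rightarrow> 'a fls"
  assumes f: "null_family f A" and g: "null_family g B"
  shows "infsum f A * infsum g B = infsum (\<lambda>(x, y). f x * g y) (A \<times> B)"
proof (rule eq_if_vanishes_below)
  fix m
  obtain M where M: "\<And>x. x \<in> A \<Longrightarrow> vanishes_below M (f x)"
    using null_family_bounded[OF f] by blast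
  obtain N where N: "\<And>y. y \<in> B \<Longrightarrow> vanishes_below N (g y)"
    using null_family_bounded[OF g] by blast
  define E where "E = {x\<in>A. \<not> vanishes_below (m - N) (f x)}"
  define D where "D = {y\<in>B. \<not> vanishes_below (m - M) (g y)}"
  have fin: "finite E" "finite D"
    unfolding E_def D_def by (intro null_familyD f g)+
  have sub: "E \<subseteq> A" "D \<subseteq> B"
    by (auto simp: E_def D_def)
  have "vanishes_below M (infsum f A)"
    using null_family_infsum[OF f, of "{}" M] M by (simp add: vanishes_below_def)
  moreover have "vanishes_below (m - M) (sum g D - infsum g B)"
    using fin sub by (intro null_family_infsum g) (auto simp: D_def)
  ultimately have 1: "vanishes_below m (infsum f A * (sum g D - infsum g B))"
    using vanishes_below_mult by fastforce
  have "vanishes_below N (sum g D)"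
    using N sub by (intro vanishes_below_sum) auto
  moreover have "vanishes_below (m - N) (sum f E - infsum f A)"
    using fin sub by (intro null_family_infsum f) (auto simp: E_def)
  ultimately have 2: "vanishes_below m ((sum f E - infsum f A) * sum g D)"
    using vanishes_below_mult by fastforce
  have 3: "vanishes_below m
      ((\<Sum>(x, y)\<in>E \<times> D. f x * g y) - infsum (\<lambda>(x, y). f x * g y) (A \<times> B))"
  proof (rule null_family_infsum[OF null_family_mult[OF f g]])
    show "vanishes_below m (case p of (x, y) \<Rightarrow> f x * g y)" if "p \<in> A \<times> B - E \<times> D" for p
      using that vanishes_below_mult[OF _ N, of "m - N"] vanishes_below_mult[OF M, of _ "m - M"]
      by (auto simp: E_def D_def)
  qed (use fin sub in auto)
  have "infsum f A * infsum g B - infsum (\<lambda>(x, y). f x * g y) (A \<times> B) =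
      ((\<Sum>(x, y)\<in>E \<times> D. f x * g y) - infsum (\<lambda>(x, y). f x * g y) (A \<times> B))
      - infsum f A * (sum g D - infsum g B) - (sum f E - infsum f A) * sum g D"
    by (simp add: algebra_simps flip: sum_product sum.cartesian_product)
  with vanishes_below_diff[OF vanishes_below_diff[OF 3 1] 2]
  show "vanishes_below m (infsum f A * infsum g B - infsum (\<lambda>(x, y). f x * g y) (A \<times> B))"
    by (simp only:)
qed

section \<open>Decay of the power sums\<close>

lemma subdegree_poly_to_Kinf:
  assumes "a \<noteq> 0"
  shows "fls_subdegree (poly_to_Kinf a) = - int (degree a)"
proof -
  have nth: "fls_nth (poly_to_Kinf a) n = (\<Sum>i\<le>degree a. if n = - int i then coeff a i else 0)"
    for n
  proof -
    have "fls_nth (fls_const c * fls_X_inv ^ i) n = (if n = - int i then c else 0)"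
      for c :: 'a and i
      by (simp add: fls_X_inv_power_times_conv_shift(2))
    thus ?thesis
      by (simp add: poly_to_Kinf_def poly_altdef degree_map_poly coeff_map_poly fls_nth_sum)
  qed
  show ?thesis
  proof (rule fls_subdegree_eqI)
    show "fls_nth (poly_to_Kinf a) (- int (degree a)) \<noteq> 0"
      using assms by (simp add: nth sum.delta)
  qed (auto simp: nth intro!: sum.neutral)
qed

lemma vanishes_below_power_sum:
  assumes "k > 0"
  shows "vanishes_below (int d) (power_sum d k)"
  unfolding power_sum_def
proof (rule vanishes_below_sum)
  fix a :: "'a poly" assume a: "a \<in> {a. lead_coeff a = 1 \<and> degree a = d}"
  hence "a \<noteq> 0" by auto
  with a have "fls_subdegree (poly_to_Kinf a powi (- int k)) = int k * int d"
    by (simp add: subdegree_poly_to_Kinf)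
  moreover have "int d \<le> int k * int d"
    using assms by (simp flip: of_nat_mult)
  ultimately show "vanishes_below (int d) (poly_to_Kinf a powi (- int k))"
    by (intro vanishes_below_le_subdegree) simp
qed

lemma null_family_multi_power_sum:
  assumes "pos_tuple r s"
  shows "null_family (\<lambda>d. multi_power_sum d s :: 'a::{field,finite} fls) {d. length d = r}"
  unfolding null_family_def
proof
  fix m
  have "{d\<in>{d. length d = r}. \<not> vanishes_below m (multi_power_sum d s :: 'a fls)}
          \<subseteq> {d. set d \<subseteq> {..<nat m} \<and> length d = r}"
  proof (intro subsetI CollectI conjI)
    fix d x
    assume d': "d \<in> {d\<in>{d. length d = r}. \<not> vanishes_below m (multi_power_sum d s :: 'a fls)}"
      and x: "x \<in> set d"
    from d' have d: "length d = r"
      and nz: "\<not> vanishes_below m (multi_power_sum d s :: 'a fls)"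
      by auto
    have len: "length s = length d" and pos: "\<And>i. i < length s \<Longrightarrow> s ! i > 0"
      using assms d by (auto simp: pos_tuple_def)
    have "vanishes_below (\<Sum>i<length s. int (d ! i)) (multi_power_sum d s :: 'a fls)"
      unfolding multi_power_sum_def
      by (intro vanishes_below_prod vanishes_below_power_sum pos) auto
    with nz have "(\<Sum>i<length s. int (d ! i)) < m"
      by (metis linorder_not_le vanishes_below_mono)
    moreover obtain i where "i < length s" "x = d ! i"
      using x len by (auto simp: in_set_conv_nth)
    hence "int x \<le> (\<Sum>i<length s. int (d ! i))"
      by (auto intro: member_le_sum)
    ultimately show "x \<in> {..<nat m}" unfolding lessThan_iff by linarith
  qed auto
  thus "finite {d\<in>{d. length d = r}. \<not> vanishes_below m (multi_power_sum d s :: 'a fls)}"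
    by (rule finite_subset) (rule finite_lists_length_eq, simp)
qed

section \<open>Splitting pairs of tuples by their joint preorder\<close>

lemma multi_power_sum_append:
  assumes "length d = length s"
  shows "multi_power_sum (d @ d') (s @ s') = multi_power_sum d s * multi_power_sum d' s'"
proof -
  have "{..<length s + length s'} = {..<length s} \<union> (\<lambda>i. length s + i) ` {..<length s'}"
    by (auto simp: image_iff Bex_def) presburger
  moreover have "{..<length s} \<inter> (\<lambda>i. length s + i) ` {..<length s'} = {}"
    by auto
  ultimately show ?thesis
    using assms
    by (simp add: multi_power_sum_def prod.union_disjoint prod.reindex nth_append)
qed

lemma bij_betw_append_tuples_of_preorder:
  "bij_betw (\<lambda>(d, d'). d @ d') (tuples_of_preorder r\<^sub>0 \<rho>\<^sub>0 \<times> tuples_of_preorder r\<^sub>1 \<rho>\<^sub>1)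
     (\<Union>\<rho>\<in>joint_preorders r\<^sub>0 \<rho>\<^sub>0 r\<^sub>1 \<rho>\<^sub>1. tuples_of_preorder (r\<^sub>0 + r\<^sub>1) \<rho>)"
    (is "bij_betw ?app (?T\<^sub>0 \<times> ?T\<^sub>1) ?U")
proof (rule bij_betw_imageI)
  show "inj_on ?app (?T\<^sub>0 \<times> ?T\<^sub>1)"
    by (auto simp: inj_on_def tuples_of_preorder_def)
  show "?app ` (?T\<^sub>0 \<times> ?T\<^sub>1) = ?U"
  proof (intro equalityI subsetI)
    fix n assume "n \<in> ?app ` (?T\<^sub>0 \<times> ?T\<^sub>1)"
    then obtain d d' where n: "n = d @ d'" and d: "d \<in> ?T\<^sub>0" and d': "d' \<in> ?T\<^sub>1"
      by auto
    define \<rho> where "\<rho> = {(i, j). i < r\<^sub>0 + r\<^sub>1 \<and> j < r\<^sub>0 + r\<^sub>1 \<and> n ! i \<le> n ! j}"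
    have "linear_preorder_on {..<r\<^sub>0 + r\<^sub>1} \<rho>"
      by (auto simp: linear_preorder_on_def \<rho>_def trans_def)
    hence "\<rho> \<in> joint_preorders r\<^sub>0 \<rho>\<^sub>0 r\<^sub>1 \<rho>\<^sub>1"
      using d d' by (auto simp: joint_preorders_def tuples_of_preorder_def \<rho>_def n nth_append)
    moreover have "n \<in> tuples_of_preorder (r\<^sub>0 + r\<^sub>1) \<rho>"
      using d d' by (auto simp: tuples_of_preorder_def \<rho>_def n)
    ultimately show "n \<in> ?U" by blast
  next
    fix n assume "n \<in> ?U"
    then obtain \<rho> where \<rho>: "\<rho> \<in> joint_preorders r\<^sub>0 \<rho>\<^sub>0 r\<^sub>1 \<rho>\<^sub>1"
      and n: "n \<in> tuples_of_preorder (r\<^sub>0 + r\<^sub>1) \<rho>"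
      by blast
    have "take r\<^sub>0 n \<in> ?T\<^sub>0" "drop r\<^sub>0 n \<in> ?T\<^sub>1"
      using \<rho> n by (auto simp: joint_preorders_def tuples_of_preorder_def)
    hence "?app (take r\<^sub>0 n, drop r\<^sub>0 n) \<in> ?app ` (?T\<^sub>0 \<times> ?T\<^sub>1)"
      by blast
    thus "n \<in> ?app ` (?T\<^sub>0 \<times> ?T\<^sub>1)" by simp
  qed
qed

lemma preorder_eq_comparison_relation:
  assumes "n \<in> tuples_of_preorder r \<rho>" "\<rho> \<subseteq> {..<r} \<times> {..<r}"
  shows "\<rho> = {(i, j). i < r \<and> j < r \<and> n ! i \<le> n ! j}"
  using assms by (auto simp: tuples_of_preorder_def dest: subsetD)

text \<open>
  Expand the product of the two sums into a sum over pairs of tuples, concatenate each pair, and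
  collect the resulting tuples by the order pattern of their entries.
\<close>

lemma multizeta_mult:
  assumes s: "pos_tuple r\<^sub>0 s\<^sub>0" "pos_tuple r\<^sub>1 s\<^sub>1"
  shows "(multizeta \<rho>\<^sub>0 s\<^sub>0 * multizeta \<rho>\<^sub>1 s\<^sub>1 :: 'a :: {field, finite} fls) =
           (\<Sum>\<rho>\<in>joint_preorders r\<^sub>0 \<rho>\<^sub>0 r\<^sub>1 \<rho>\<^sub>1. multizeta \<rho> (s\<^sub>0 @ s\<^sub>1))"
proof -
  let ?J = "joint_preorders r\<^sub>0 \<rho>\<^sub>0 r\<^sub>1 \<rho>\<^sub>1"
  let ?T = "\<lambda>\<rho>. tuples_of_preorder (r\<^sub>0 + r\<^sub>1) \<rho>"
  let ?T\<^sub>0 = "tuples_of_preorder r\<^sub>0 \<rho>\<^sub>0" and ?T\<^sub>1 = "tuples_of_preorder r\<^sub>1 \<rho>\<^sub>1"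
  let ?f = "\<lambda>d. multi_power_sum d (s\<^sub>0 @ s\<^sub>1) :: 'a fls"
  have len: "length s\<^sub>0 = r\<^sub>0" "length s\<^sub>1 = r\<^sub>1"
    using s by (auto simp: pos_tuple_def)
  have null: "null_family (\<lambda>d. multi_power_sum d s :: 'a fls) (tuples_of_preorder r \<rho>)"
    if "pos_tuple r s" for r s \<rho>
    using null_family_multi_power_sum[OF that]
    by (rule null_family_subset) (auto simp: tuples_of_preorder_def)
  have "pos_tuple (r\<^sub>0 + r\<^sub>1) (s\<^sub>0 @ s\<^sub>1)"
    using s by (auto simp: pos_tuple_def)
  hence nullU: "null_family ?f (\<Union>\<rho>\<in>?J. ?T \<rho>)"
    by (rule null_family_subset[OF null_family_multi_power_sum]) (auto simp: tuples_of_preorder_def)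
  have disj: "disjoint_family_on ?T ?J"
    unfolding disjoint_family_on_def
  proof (intro ballI impI)
    fix \<rho> \<sigma> assume "\<rho> \<in> ?J" "\<sigma> \<in> ?J" "\<rho> \<noteq> \<sigma>"
    hence sub: "\<rho> \<subseteq> {..<r\<^sub>0 + r\<^sub>1} \<times> {..<r\<^sub>0 + r\<^sub>1}" "\<sigma> \<subseteq> {..<r\<^sub>0 + r\<^sub>1} \<times> {..<r\<^sub>0 + r\<^sub>1}"
      by (simp_all add: joint_preorders_def linear_preorder_on_def)
    have "\<rho> = \<sigma>" if "n \<in> ?T \<rho>" "n \<in> ?T \<sigma>" for n
      using preorder_eq_comparison_relation[OF that(1) sub(1)]
            preorder_eq_comparison_relation[OF that(2) sub(2)] by (rule trans[OF _ sym])
    with \<open>\<rho> \<noteq> \<sigma>\<close> show "?T \<rho> \<inter> ?T \<sigma> = {}"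
      by blast
  qed
  have "multizeta \<rho>\<^sub>0 s\<^sub>0 * multizeta \<rho>\<^sub>1 s\<^sub>1 =
          infsum (\<lambda>(d, d'). multi_power_sum d s\<^sub>0 * multi_power_sum d' s\<^sub>1 :: 'a fls) (?T\<^sub>0 \<times> ?T\<^sub>1)"
    unfolding multizeta_def len by (intro infsum_mult_null_family null s)
  also have "\<dots> = infsum (\<lambda>p. ?f (case p of (d, d') \<Rightarrow> d @ d')) (?T\<^sub>0 \<times> ?T\<^sub>1)"
    by (intro infsum_cong)
       (auto simp: tuples_of_preorder_def len intro!: multi_power_sum_append[symmetric])
  also have "\<dots> = infsum ?f (\<Union>\<rho>\<in>?J. ?T \<rho>)"
    by (rule infsum_reindex_bij_betw[OF bij_betw_append_tuples_of_preorder])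
  also have "\<dots> = (\<Sum>\<rho>\<in>?J. infsum ?f (?T \<rho>))"
    by (rule infsum_Union_null_family[OF nullU finite_joint_preorders disj])
  also have "\<dots> = (\<Sum>\<rho>\<in>?J. multizeta \<rho> (s\<^sub>0 @ s\<^sub>1))"
    by (simp add: multizeta_def len)
  finally show ?thesis .
qed

section \<open>The span of the multizeta values\<close>

lemma module_of_int: "module (\<lambda>(n :: int) (x :: 'a::ring_1). of_int n * x)"
  by unfold_locales (simp_all add: algebra_simps)

text \<open>
  This makes the theory of modules available for \<open>Fp_span\<close>, as \<open>\<F>\<^sub>p\<close> is a subset of the field and
  not a type, while \<open>int\<close> is one.
\<close>

lemma Fp_span_eq_int_span:
  fixes V :: "'a::{field, finite} fls set"
  shows "Fp_span V = module.span (\<lambda>(n :: int) (x :: 'a fls). of_int n * x) V"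
proof -
  interpret module "\<lambda>(n :: int) (x :: 'a fls). of_int n * x"
    by (rule module_of_int)
  show ?thesis
  proof (intro equalityI subsetI)
    fix x assume "x \<in> Fp_span V"
    then obtain T c where T: "finite T" "T \<subseteq> V" "x = (\<Sum>v\<in>T. fls_const (c v) * v)"
      and c: "\<forall>v\<in>T. c v \<in> prime_subfield"
      unfolding Fp_span_def by blast
    from c obtain n where n: "\<forall>v\<in>T. c v = of_int (n v)"
      unfolding prime_subfield_def image_iff by (metis UNIV_I)
    have "x = (\<Sum>v\<in>T. of_int (n v) * v)"
      unfolding T(3) using n by (intro sum.cong) (auto simp: fls_of_int)
    thus "x \<in> span V"
      using T by (auto simp: span_explicit)
  next
    fix x assume "x \<in> span V"
    then obtain T n where "finite T" "T \<subseteq> V" "x = (\<Sum>v\<in>T. of_int (n v) * v)"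
      unfolding span_explicit by blast
    thus "x \<in> Fp_span V"
      unfolding Fp_span_def prime_subfield_def
      by (intro CollectI exI[of _ T] exI[of _ "\<lambda>v. of_int (n v)"]) (auto simp: fls_of_int)
  qed
qed

lemma Fp_subalgebra_Fp_span:
  fixes V :: "'a::{field, finite} fls set"
  assumes mult: "\<And>v w. v \<in> V \<Longrightarrow> w \<in> V \<Longrightarrow> v * w \<in> Fp_span V"
  shows "Fp_subalgebra (Fp_span V)"
proof -
  interpret module "\<lambda>(n :: int) (x :: 'a fls). of_int n * x"
    by (rule module_of_int)
  note eq = Fp_span_eq_int_span[of V]
  have 1: "v * y \<in> span V" if v: "v \<in> V" and y: "y \<in> span V" for v y
    using y
  proof (induction rule: span_induct)
    case base
    show "subspace {y. v * y \<in> span V}"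
      by (auto simp: subspace_def distrib_left span_zero span_add mult.left_commute[of v]
               intro: span_scale)
  next
    case (step w)
    with mult[OF v step] show "v * w \<in> span V" by (simp add: eq)
  qed
  have 2: "x * y \<in> span V" if x: "x \<in> span V" and y: "y \<in> span V" for x y
    using x
  proof (induction rule: span_induct)
    case base
    show "subspace {x. x * y \<in> span V}"
      by (auto simp: subspace_def distrib_right span_zero span_add mult.assoc
               intro: span_scale)
  next
    case (step v)
    with 1 y show "v * y \<in> span V" by blast
  qed
  have 3: "fls_const c * x \<in> span V" if "c \<in> prime_subfield" "x \<in> span V" for c x
    using that span_scale by (auto simp: prime_subfield_def simp flip: fls_of_int)
  show ?thesis
    unfolding Fp_subalgebra_def eq
    by (auto intro: span_zero span_add 2 3)
qed

lemma multizeta_values_mult: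
  assumes "v \<in> multizeta_values" "w \<in> multizeta_values"
  shows "v * w \<in> Fp_span (multizeta_values :: 'a::{field, finite} fls set)"
proof -
  interpret module "\<lambda>(n :: int) (x :: 'a fls). of_int n * x"
    by (rule module_of_int)
  from assms(1) obtain r\<^sub>0 s\<^sub>0 \<rho>\<^sub>0 where v: "v = multizeta \<rho>\<^sub>0 s\<^sub>0" "r\<^sub>0 \<ge> 1" "pos_tuple r\<^sub>0 s\<^sub>0"
    unfolding multizeta_values_def by blast
  from assms(2) obtain r\<^sub>1 s\<^sub>1 \<rho>\<^sub>1 where w: "w = multizeta \<rho>\<^sub>1 s\<^sub>1" "r\<^sub>1 \<ge> 1" "pos_tuple r\<^sub>1 s\<^sub>1"
    unfolding multizeta_values_def by blast
  have "multizeta \<rho> (s\<^sub>0 @ s\<^sub>1) \<in> (multizeta_values :: 'a fls set)"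
    if "\<rho> \<in> joint_preorders r\<^sub>0 \<rho>\<^sub>0 r\<^sub>1 \<rho>\<^sub>1" for \<rho>
    unfolding multizeta_values_def using that v w
    by (intro CollectI exI[of _ "r\<^sub>0 + r\<^sub>1"] exI[of _ "s\<^sub>0 @ s\<^sub>1"] exI[of _ \<rho>])
       (auto simp: joint_preorders_def pos_tuple_def)
  thus ?thesis
    unfolding v(1) w(1) multizeta_mult[OF v(3) w(3)] Fp_span_eq_int_span
    by (intro span_sum span_base)
qed

theorem mainTheorem2:
  shows "(\<forall>(r\<^sub>0 :: nat) (r\<^sub>1 :: nat) (s\<^sub>0 :: nat list) (s\<^sub>1 :: nat list)
            (\<rho>\<^sub>0 :: nat rel) (\<rho>\<^sub>1 :: nat rel).
            r\<^sub>0 \<ge> 1 \<and> r\<^sub>1 \<ge> 1 \<and> pos_tuple r\<^sub>0 s\<^sub>0 \<and> pos_tuple r\<^sub>1 s\<^sub>1 \<and>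
            linear_preorder_on {..<r\<^sub>0} \<rho>\<^sub>0 \<and> linear_preorder_on {..<r\<^sub>1} \<rho>\<^sub>1 \<longrightarrow>
            (multizeta \<rho>\<^sub>0 s\<^sub>0 * multizeta \<rho>\<^sub>1 s\<^sub>1 :: 'a :: {field, finite} fls) =
              (\<Sum>\<rho>\<in>joint_preorders r\<^sub>0 \<rho>\<^sub>0 r\<^sub>1 \<rho>\<^sub>1. multizeta \<rho> (s\<^sub>0 @ s\<^sub>1))) \<and>
         Fp_subalgebra (Fp_span (multizeta_values :: 'a fls set))"
proof (intro conjI allI impI)
  show "Fp_subalgebra (Fp_span (multizeta_values :: 'a fls set))"
    by (rule Fp_subalgebra_Fp_span[OF multizeta_values_mult])
qed (elim conjE, rule multizeta_mult)

end
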